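(* Let $X$ be a metric space and let $\nu,\nu_1,\nu_2,\dots\in\mathcal{M}(X)$ be Borel probability measures such that $\nu_n\to\nu$ setwisely as $n\to\infty$. Then $$\liminf_{n\to\infty}\dim_H^1\nu_n\ \ge\ \dim_H^1\nu .$$
   Context: $\mathcal{M}(X)$ is the set of all probability measures on $(X,\mathscr{A})$, where $\mathscr{A}$ is the Borel $\sigma$-algebra of the metric space $X$. $HD(A)$ denotes the Hausdorff dimension of $A\subset X$. The upper measure-dimension mapping is $$\dim_H^1\nu=\inf\{HD(A):\ A\in\mathscr{A},\ \nu(A)=1\}.$$ A sequence $\nu_n\in\mathcal{M}(X)$ converges setwisely to $\nu\in\mathcal{M}(X)$ if $\lim_{n\to\infty}\nu_n(A)=\nu(A)$ for every $A\in\mathscr{A}$. *)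

theory Defs
  imports "HOL-Probability.Probability_Measure"
begin

(* The s-th power of the diameter of U, with the usual conventions: the empty set has
   weight 0 for every s, and a nonempty set has weight 1 for s = 0 (whereas "0 powr 0 = 0"). *)
definition diam_power :: "real \<Rightarrow> 'a::metric_space set \<Rightarrow> ennreal" where
  "diam_power s U =
     (if U = {} then 0 else if s = 0 then 1 else ennreal (diameter U powr s))"

(* Boundedness is required explicitly because "diameter" is unspecified on unbounded sets. *)
definition delta_covers :: "real \<Rightarrow> 'a::metric_space set \<Rightarrow> (nat \<Rightarrow> 'a set) set" where
  "delta_covers \<delta> A = {U. A \<subseteq> (\<Union>i. U i) \<and> (\<forall>i. bounded (U i) \<and> diameter (U i) \<le> \<delta>)}"

(* If A has no countable cover by sets of diameter at most \<delta> (possible when the space is not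
   separable), the infimum is over the empty set and equals \<infinity>. *)
definition hausdorff_premeasure :: "real \<Rightarrow> real \<Rightarrow> 'a::metric_space set \<Rightarrow> ennreal" where
  "hausdorff_premeasure s \<delta> A = (INF U\<in>delta_covers \<delta> A. \<Sum>i. diam_power s (U i))"

definition hausdorff_measure :: "real \<Rightarrow> 'a::metric_space set \<Rightarrow> ennreal" where
  "hausdorff_measure s A = (SUP \<delta>\<in>{0<..}. hausdorff_premeasure s \<delta> A)"

(* Takes the value \<infinity> if no finite s \<ge> 0 has vanishing Hausdorff measure; the empty set
   gets dimension 0. *)
definition hausdorff_dim :: "'a::metric_space set \<Rightarrow> ennreal" where
  "hausdorff_dim A = (INF s\<in>{s. 0 \<le> s \<and> hausdorff_measure s A = 0}. ennreal s)"

definition borel_prob_measures :: "'a::metric_space measure set" where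
  "borel_prob_measures = {\<nu>. prob_space \<nu> \<and> sets \<nu> = sets borel}"

definition upper_measure_dim :: "'a::metric_space measure \<Rightarrow> ennreal" where
  "upper_measure_dim \<nu> = (INF A\<in>{A \<in> sets borel. measure \<nu> A = 1}. hausdorff_dim A)"

definition setwise_converges ::
    "(nat \<Rightarrow> 'a::metric_space measure) \<Rightarrow> 'a measure \<Rightarrow> bool" where
  "setwise_converges \<nu>s \<nu> \<longleftrightarrow>
     (\<forall>A\<in>sets borel. (\<lambda>n. measure (\<nu>s n) A) \<longlonglongrightarrow> measure \<nu> A)"

end

theory Submission
  imports Defs
begin

text \<open>
  The upper measure-dimension is lower semicontinuous along setwise convergent sequences because
  Hausdorff dimension is countably stable.  Suppose \<open>y < dim \<nu>\<close> but \<open>dim \<nu>\<^sub>n \<le> y\<close> for infinitely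
  many \<open>n\<close>, and pick \<open>r\<close> strictly between \<open>y\<close> and \<open>dim \<nu>\<close>.  Each of these infinitely many measures is
  carried by a Borel set \<open>A\<^sub>n\<close> of Hausdorff dimension below \<open>r\<close>.  The union \<open>B\<close> of these sets is
  again of dimension at most \<open>r\<close>, and it has full measure for all these \<open>\<nu>\<^sub>n\<close> at once, so that a
  single instance of the convergence, \<open>\<nu>\<^sub>n B \<longlonglongrightarrow> \<nu> B\<close>, forces \<open>\<nu> B = 1\<close>.  Hence \<open>dim \<nu> \<le> r\<close>, a
  contradiction.

  Countable stability rests on two properties of the \<open>s\<close>-dimensional null sets: they are closed
  under countable unions (\<open>hausdorff_null_UN\<close>), and they remain null when \<open>s\<close> increases
  (\<open>hausdorff_null_mono_exponent\<close>).  The second property brings the sets \<open>A\<^sub>n\<close>, which come with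
  different exponents, to the common exponent \<open>r\<close>.
\<close>

lemma hausdorff_null_iff:
  "hausdorff_measure s A = 0 \<longleftrightarrow> (\<forall>\<delta>>0. hausdorff_premeasure s \<delta> A = 0)"
  unfolding hausdorff_measure_def using SUP_bot_conv(1)[where 'a = ennreal]
  by (simp only: bot_ennreal) auto

lemma hausdorff_premeasure_antimono_delta:
  assumes "\<delta> \<le> \<delta>'"
  shows "hausdorff_premeasure s \<delta>' A \<le> hausdorff_premeasure s \<delta> A"
  unfolding hausdorff_premeasure_def
  by (rule INF_superset_mono) (use assms in \<open>auto simp: delta_covers_def intro: order_trans\<close>)

lemma diam_power_antimono_exponent:
  assumes "0 \<le> s" "s \<le> t" "bounded U" "diameter U \<le> 1"
  shows "diam_power t U \<le> diam_power s U"
proof -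
  have "0 \<le> diameter U"
    by (rule diameter_ge_0) (fact assms)
  then have "diameter U powr t \<le> diameter U powr s" "diameter U powr t \<le> 1"
    using assms by (auto intro: powr_mono' powr_le1)
  then show ?thesis
    using assms by (auto simp: diam_power_def intro: ennreal_leI)
qed

text \<open>
  Powers of a diameter decrease in the exponent only for diameters at most \<open>1\<close>, but it suffices to
  consider covers that are that fine, since the premeasure grows as \<open>\<delta>\<close> shrinks.
\<close>
lemma hausdorff_null_mono_exponent:
  assumes "hausdorff_measure s A = 0" "0 \<le> s" "s \<le> t"
  shows "hausdorff_measure t A = 0"
  unfolding hausdorff_null_iff
proof (intro allI impI)
  fix \<delta> :: real assume "\<delta> > 0"
  define \<epsilon> where "\<epsilon> = min \<delta> 1"
  have "hausdorff_premeasure t \<delta> A \<le> hausdorff_premeasure t \<epsilon> A"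
    by (rule hausdorff_premeasure_antimono_delta) (simp add: \<epsilon>_def)
  also have "\<dots> \<le> hausdorff_premeasure s \<epsilon> A"
    unfolding hausdorff_premeasure_def
  proof (rule INF_mono, rule bexI)
    fix U assume "U \<in> delta_covers \<epsilon> A"
    then show "(\<Sum>i. diam_power t (U i)) \<le> (\<Sum>i. diam_power s (U i))"
      using assms(2,3)
      by (intro suminf_le diam_power_antimono_exponent) (auto simp: delta_covers_def \<epsilon>_def)
  qed
  also have "\<dots> = 0"
    using assms(1) \<open>\<delta> > 0\<close> by (simp add: hausdorff_null_iff \<epsilon>_def)
  finally show "hausdorff_premeasure t \<delta> A = 0" by simp
qed

text \<open>
  A premeasure equal to \<open>0\<close> yields covers of the \<open>n\<close>-th set of total weight below \<open>e / 2 ^ Suc n\<close>;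
  enumerating all of them along \<open>prod_decode\<close> covers the union with total weight at most \<open>e\<close>.
\<close>
lemma hausdorff_premeasure_UN_eq_0:
  assumes null: "\<And>n::nat. hausdorff_premeasure s \<delta> (A n) = 0"
  shows "hausdorff_premeasure s \<delta> (\<Union>n. A n) = 0"
proof -
  have "hausdorff_premeasure s \<delta> (\<Union>n. A n) \<le> 0 + ennreal e" if "e > 0" for e :: real
  proof -
    have "\<exists>U\<in>delta_covers \<delta> (A n). (\<Sum>i. diam_power s (U i)) < ennreal (e * (1/2) ^ Suc n)" for n
    proof -
      have "hausdorff_premeasure s \<delta> (A n) < ennreal (e * (1/2) ^ Suc n)"
        using \<open>e > 0\<close> by (simp add: null)
      then show ?thesis by (simp only: hausdorff_premeasure_def INF_less_iff)
    qed
    then obtain U where U: "\<And>n. U n \<in> delta_covers \<delta> (A n)"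
      and weight: "\<And>n. (\<Sum>i. diam_power s (U n i)) < ennreal (e * (1/2) ^ Suc n)"
      by metis
    define V where "V k = (case prod_decode k of (n, i) \<Rightarrow> U n i)" for k
    have "V \<in> delta_covers \<delta> (\<Union>n. A n)"
    proof -
      have U_V: "U n i \<subseteq> (\<Union>k. V k)" for n i
        using UN_upper[of "prod_encode (n, i)" UNIV V] by (simp add: V_def)
      have A_U: "A n \<subseteq> (\<Union>i. U n i)" for n
        using U[of n] by (simp add: delta_covers_def)
      have "(\<Union>n. A n) \<subseteq> (\<Union>k. V k)"
        by (intro UN_least order_trans[OF A_U] U_V)
      moreover have "bounded (V k) \<and> diameter (V k) \<le> \<delta>" for k
        using U by (auto simp: V_def delta_covers_def split: prod.split)
      ultimately show ?thesis by (simp add: delta_covers_def)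
    qed
    then have "hausdorff_premeasure s \<delta> (\<Union>n. A n) \<le> (\<Sum>k. diam_power s (V k))"
      unfolding hausdorff_premeasure_def by (rule INF_lower)
    also have "\<dots> = (\<Sum>n. \<Sum>i. diam_power s (U n i))"
      using suminf_ennreal_2dimen[of "\<lambda>n. \<Sum>i. diam_power s (U n i)"
          "\<lambda>(n, i). diam_power s (U n i)"]
      by (simp add: V_def case_prod_unfold)
    also have "\<dots> \<le> (\<Sum>n. ennreal (e * (1/2) ^ Suc n))"
      by (intro suminf_le less_imp_le[OF weight]) auto
    also have "\<dots> = ennreal e"
      using sums_mult[OF power_half_series, of e] \<open>e > 0\<close> by (intro suminf_ennreal_eq) auto
    finally show ?thesis by simp
  qed
  then have "hausdorff_premeasure s \<delta> (\<Union>n. A n) \<le> 0"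
    by (rule ennreal_le_epsilon)
  then show ?thesis by simp
qed

lemma hausdorff_null_empty: "hausdorff_measure s ({} :: 'a::metric_space set) = 0"
proof -
  have "hausdorff_premeasure s \<delta> ({} :: 'a set) \<le> (\<Sum>i::nat. diam_power s ({} :: 'a set))" if "\<delta> > 0" for \<delta>
    unfolding hausdorff_premeasure_def
    by (rule INF_lower2[where i = "\<lambda>_. {}"]) (use that in \<open>auto simp: delta_covers_def\<close>)
  then show ?thesis
    by (simp add: hausdorff_null_iff diam_power_def)
qed

lemma hausdorff_null_UN:
  assumes "countable I" and null: "\<And>i. i \<in> I \<Longrightarrow> hausdorff_measure s (A i) = 0"
  shows "hausdorff_measure s (\<Union>i\<in>I. A i) = 0"
proof (cases "I = {}")
  case True
  then show ?thesis by (simp add: hausdorff_null_empty)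
next
  case False
  have "(\<Union>i\<in>I. A i) = (\<Union>n. A (from_nat_into I n))"
    using range_from_nat_into[OF False assms(1)] by (metis image_image)
  moreover have "hausdorff_measure s (A (from_nat_into I n)) = 0" for n
    by (rule null) (rule from_nat_into[OF False])
  ultimately show ?thesis
    by (simp add: hausdorff_null_iff hausdorff_premeasure_UN_eq_0)
qed

lemma hausdorff_dim_less_imp_null:
  assumes "hausdorff_dim A < ennreal r"
  shows "hausdorff_measure r A = 0"
proof -
  obtain s where "0 \<le> s" "hausdorff_measure s A = 0" "ennreal s < ennreal r"
    using assms by (auto simp: hausdorff_dim_def INF_less_iff)
  then show ?thesis
    by (intro hausdorff_null_mono_exponent[of s A r]) (auto simp: ennreal_less_iff)
qed

lemma hausdorff_dim_le_if_null:
  assumes "0 \<le> r" "hausdorff_measure r A = 0"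
  shows "hausdorff_dim A \<le> ennreal r"
  unfolding hausdorff_dim_def by (rule INF_lower) (simp add: assms)

theorem theorem2p4:
  fixes \<nu> :: "'a::metric_space measure" and \<nu>s :: "nat \<Rightarrow> 'a measure"
  assumes "\<nu> \<in> borel_prob_measures"
    and "\<And>n. \<nu>s n \<in> borel_prob_measures"
    and "setwise_converges \<nu>s \<nu>"
  shows "liminf (\<lambda>n. upper_measure_dim (\<nu>s n)) \<ge> upper_measure_dim \<nu>"
  unfolding le_Liminf_iff
proof (intro allI impI, rule ccontr)
  fix y assume "y < upper_measure_dim \<nu>"
  assume "\<not> (\<forall>\<^sub>F n in sequentially. y < upper_measure_dim (\<nu>s n))"
  then have low: "\<exists>\<^sub>F n in sequentially. upper_measure_dim (\<nu>s n) \<le> y"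
    by (simp add: frequently_def not_le)
  obtain t where "y < t" and t: "t < upper_measure_dim \<nu>"
    using dense[OF \<open>y < upper_measure_dim \<nu>\<close>] by blast
  from t have "t < top"
    by (rule order.strict_trans2) simp
  then obtain r where r: "0 \<le> r" "t = ennreal r"
    by (cases t) auto
  define N where "N = {n. upper_measure_dim (\<nu>s n) < t}"
  have "\<forall>n\<in>N. \<exists>A. A \<in> sets borel \<and> measure (\<nu>s n) A = 1 \<and> hausdorff_dim A < t"
    by (auto simp: N_def upper_measure_dim_def INF_less_iff)
  then obtain A where A: "\<And>n. n \<in> N \<Longrightarrow> A n \<in> sets borel"
      "\<And>n. n \<in> N \<Longrightarrow> measure (\<nu>s n) (A n) = 1" "\<And>n. n \<in> N \<Longrightarrow> hausdorff_dim (A n) < t"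
    by metis
  define B where "B = (\<Union>n\<in>N. A n)"
  have B: "B \<in> sets borel"
    unfolding B_def using A(1) by (intro sets.countable_UN') auto
  have full: "measure (\<nu>s n) B = 1" if "n \<in> N" for n
  proof -
    interpret prob_space "\<nu>s n"
      using assms(2) by (simp add: borel_prob_measures_def)
    have "sets (\<nu>s n) = sets borel"
      using assms(2) by (simp add: borel_prob_measures_def)
    then have "measure (\<nu>s n) (A n) \<le> measure (\<nu>s n) B"
      using B that by (intro finite_measure_mono) (auto simp: B_def)
    then show ?thesis
      using A(2)[OF that] prob_le_1[of B] by simp
  qed
  have "measure \<nu> B = 1"
  proof (rule ccontr)
    assume "measure \<nu> B \<noteq> 1"
    moreover have "(\<lambda>n. measure (\<nu>s n) B) \<longlonglongrightarrow> measure \<nu> B"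
      using assms(3) B by (simp add: setwise_converges_def)
    ultimately have "\<forall>\<^sub>F n in sequentially. measure (\<nu>s n) B \<noteq> 1"
      by (rule tendsto_imp_eventually_ne[rotated])
    with low have "\<exists>\<^sub>F n in sequentially.
        upper_measure_dim (\<nu>s n) \<le> y \<and> measure (\<nu>s n) B \<noteq> 1"
      by (rule frequently_eventually_frequently)
    then obtain n where "upper_measure_dim (\<nu>s n) \<le> y" "measure (\<nu>s n) B \<noteq> 1"
      by (auto dest: frequently_ex)
    then show False
      using full[of n] \<open>y < t\<close> by (auto simp: N_def)
  qed
  then have "upper_measure_dim \<nu> \<le> hausdorff_dim B"
    unfolding upper_measure_dim_def using B by (intro INF_lower) simp
  moreover have "hausdorff_measure r B = 0"
    unfolding B_def
  proof (rule hausdorff_null_UN)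
    show "hausdorff_measure r (A n) = 0" if "n \<in> N" for n
      using A(3)[OF that] unfolding r(2) by (rule hausdorff_dim_less_imp_null)
  qed simp
  then have "hausdorff_dim B \<le> t"
    unfolding r(2) by (rule hausdorff_dim_le_if_null[OF r(1)])
  ultimately show False
    using t by simp
qed

end
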